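(* Let $n\geqslant 2$ be an integer, let $(X,d)$ be a complete metric space with $|X|\geqslant n$, and let $T\colon X\to X$ be a mapping contracting total pairwise distance on $n$ points. Then $T$ has a periodic point of prime period $k$ for some $k\in\{1,\ldots,n-1\}$. Moreover, the number of periodic points of $T$ (of any period) is at most $n-1$.
   Context: $|X|$ denotes the cardinality of $X$. For points $x_1,\ldots,x_n$ of a metric space $(X,d)$, $n\geqslant 2$, the total pairwise distance is $S(x_1,\ldots,x_n)=\sum_{1\leqslant i<j\leqslant n} d(x_i,x_j)$. Let $n\geqslant 2$ and let $(X,d)$ be a metric space with $|X|\geqslant n$. A map $T\colon X\to X$ is a mapping contracting total pairwise distance on $n$ points if there exists $\alpha\in[0,1)$ such that $S(Tx_1,\ldots,Tx_n)\leqslant \alpha\, S(x_1,\ldots,x_n)$ for all $n$ pairwise distinct points $x_1,\ldots,x_n\in X$. A point $x\in X$ is a periodic point of $T$ of period $m$ ($m$ a positive integer) if $T^m(x)=x$; the least positive integer $m$ with $T^m(x)=x$ is the prime period of $x$. A fixed point is a point of prime period $1$. *)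

theory Defs
  imports "HOL-Analysis.Analysis" "HOL-Combinatorics.Cycles"
begin

(* The n points x_1, ..., x_n are represented by a family x :: nat => 'a,
   of which only the values x 0, ..., x (n - 1) matter. *)

definition total_pairwise_dist :: "nat \<Rightarrow> (nat \<Rightarrow> 'a::metric_space) \<Rightarrow> real"
  where "total_pairwise_dist n x = (\<Sum>(i, j) \<in> {(i, j). i < j \<and> j < n}. dist (x i) (x j))"

definition contracting_total_pairwise_dist :: "nat \<Rightarrow> ('a::metric_space \<Rightarrow> 'a) \<Rightarrow> bool"
  where "contracting_total_pairwise_dist n T \<longleftrightarrow>
    (\<exists>\<alpha>. 0 \<le> \<alpha> \<and> \<alpha> < 1 \<and>
      (\<forall>x. inj_on x {..<n} \<longrightarrow>
        total_pairwise_dist n (\<lambda>i. T (x i)) \<le> \<alpha> * total_pairwise_dist n x))"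

definition periodic_point :: "('a \<Rightarrow> 'a) \<Rightarrow> nat \<Rightarrow> 'a \<Rightarrow> bool"
  where "periodic_point T m x \<longleftrightarrow> m > 0 \<and> (T ^^ m) x = x"

(* least_power T x is the least positive m with (T ^^ m) x = x, but it is only
   meaningful if some such m exists; hence the first conjunct. *)
definition has_prime_period :: "('a \<Rightarrow> 'a) \<Rightarrow> nat \<Rightarrow> 'a \<Rightarrow> bool"
  where "has_prime_period T k x \<longleftrightarrow> periodic_point T k x \<and> least_power T x = k"

end

(* Suppose there are n distinct periodic points, and let N be a common period. The iterates of T are
   injective on these points, so the contraction inequality applies N times and strictly shrinks
   their positive total distance; but T^N fixes each of them. Hence there are at most n - 1 periodic
   points, and since a cycle consists of periodic points, every prime period is at most n - 1.
   For existence, take any orbit. If it repeats a value, it runs into a cycle. Otherwise any n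
   consecutive orbit points are distinct, so consecutive distances decay geometrically and the
   orbit converges to some p; applying the contraction inequality to p together with n - 1
   consecutive orbit points shows that p is a fixed point. *)
theory Submission
  imports Defs
begin

section \<open>Total pairwise distance\<close>

lemma finite_index_pairs [simp]: "finite {(i, j). i < j \<and> j < (n::nat)}"
  by (rule finite_subset[of _ "{..<n} \<times> {..<n}"]) auto

text \<open>All summands are nonnegative. This is how single distances are extracted from the
  contraction inequality.\<close>

lemma dist_le_total_pairwise_dist:
  assumes "i < j" "j < n"
  shows "dist (x i) (x j) \<le> total_pairwise_dist n x"
proof -
  have "dist (x i) (x j) = (\<Sum>(i, j)\<in>{(i, j)}. dist (x i) (x j))"
    by simp
  also have "\<dots> \<le> total_pairwise_dist n x"
    unfolding total_pairwise_dist_def using assms by (intro sum_mono2) auto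
  finally show ?thesis .
qed

lemma total_pairwise_dist_cong:
  assumes "\<And>i. i < n \<Longrightarrow> x i = y i"
  shows "total_pairwise_dist n x = total_pairwise_dist n y"
  unfolding total_pairwise_dist_def using assms by (intro sum.cong) auto

lemma total_pairwise_dist_tendsto_0:
  assumes "\<And>i. i < n \<Longrightarrow> (\<lambda>k. x k i) \<longlonglongrightarrow> p"
  shows "(\<lambda>k. total_pairwise_dist n (x k)) \<longlonglongrightarrow> 0"
  unfolding total_pairwise_dist_def
proof (rule tendsto_null_sum, clarify)
  fix i j :: nat
  assume "i < j" "j < n"
  then have "(\<lambda>k. dist (x k i) (x k j)) \<longlonglongrightarrow> dist p p"
    by (intro tendsto_dist assms) auto
  then show "(\<lambda>k. dist (x k i) (x k j)) \<longlonglongrightarrow> 0"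
    by simp
qed

text \<open>The contraction inequality is only available for distinct points, so injectivity is
  required after every number of iterations, not just initially. The lemma serves both tuples of
  periodic points and windows of an orbit.\<close>

lemma total_pairwise_dist_funpow_le:
  fixes T :: "'a::metric_space \<Rightarrow> 'a"
  assumes "0 \<le> \<alpha>"
    and contr: "\<And>x. inj_on x {..<n} \<Longrightarrow>
      total_pairwise_dist n (\<lambda>i. T (x i)) \<le> \<alpha> * total_pairwise_dist n x"
    and inj: "\<And>k. inj_on (\<lambda>i. (T ^^ k) (x i)) {..<n}"
  shows "total_pairwise_dist n (\<lambda>i. (T ^^ k) (x i)) \<le> \<alpha> ^ k * total_pairwise_dist n x"
proof (induction k)
  case (Suc k)
  have "total_pairwise_dist n (\<lambda>i. (T ^^ Suc k) (x i))
      \<le> \<alpha> * total_pairwise_dist n (\<lambda>i. (T ^^ k) (x i))"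
    using contr[OF inj[of k]] by simp
  also have "\<dots> \<le> \<alpha> * (\<alpha> ^ k * total_pairwise_dist n x)"
    by (intro mult_left_mono Suc.IH \<open>0 \<le> \<alpha>\<close>)
  finally show ?case
    by (simp add: mult.assoc)
qed simp

section \<open>Bounding the number of periodic points\<close>

lemma funpow_fixed_mult:
  assumes "(T ^^ m) x = x" "m dvd N"
  shows "(T ^^ N) x = x"
  using funpow_mod_eq[OF assms(1), of N] assms(2) by simp

text \<open>On \<open>A\<close>, the power \<open>N * k - k\<close> of \<open>T\<close> is a left
  inverse of the power \<open>k\<close>, because the exponents add up to a multiple of
  \<open>N\<close>.\<close>

lemma inj_on_funpow_of_fixed:
  assumes "N > 0" "\<And>x. x \<in> A \<Longrightarrow> (T ^^ N) x = x"
  shows "inj_on (T ^^ k) A"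
proof (rule inj_onI)
  fix x y
  assume xy: "x \<in> A" "y \<in> A" "(T ^^ k) x = (T ^^ k) y"
  have *: "(T ^^ (N * k - k)) ((T ^^ k) z) = z" if "z \<in> A" for z
  proof -
    have "(T ^^ (N * k - k)) ((T ^^ k) z) = (T ^^ (N * k - k + k)) z"
      by (simp add: funpow_add)
    \<comment> \<open>Positivity of \<open>N\<close> ensures \<open>k\<close> \<le>
      \<open>N * k\<close>, so the truncated subtraction is exact.\<close>
    also have "N * k - k + k = N * k"
      using assms(1) by (cases N) auto
    also have "(T ^^ (N * k)) z = z"
      by (rule funpow_fixed_mult[OF assms(2)[OF that]]) simp
    finally show ?thesis .
  qed
  have "x = (T ^^ (N * k - k)) ((T ^^ k) x)"
    by (rule *[OF xy(1), symmetric])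
  also have "\<dots> = (T ^^ (N * k - k)) ((T ^^ k) y)"
    by (simp only: xy(3))
  also have "\<dots> = y"
    by (rule *[OF xy(2)])
  finally show "x = y" .
qed

lemma finite_periodic_points:
  assumes "n \<ge> 2" "contracting_total_pairwise_dist n T"
  shows "finite {x. \<exists>m. periodic_point T m x} \<and> card {x. \<exists>m. periodic_point T m x} \<le> n - 1"
\<comment> \<open>A uniform bound on the finite subsets yields finiteness and the bound on the
  cardinality together.\<close>
proof (rule finite_if_finite_subsets_card_bdd, rule ccontr)
  fix G
  assume G: "G \<subseteq> {x. \<exists>m. periodic_point T m x}" "finite G" "\<not> card G \<le> n - 1"
  obtain \<alpha> where \<alpha>: "0 \<le> \<alpha>" "\<alpha> < 1"
    and contr: "\<And>x. inj_on x {..<n} \<Longrightarrow>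
      total_pairwise_dist n (\<lambda>i. T (x i)) \<le> \<alpha> * total_pairwise_dist n x"
    using assms(2) unfolding contracting_total_pairwise_dist_def by blast
  have "\<forall>x\<in>G. \<exists>m. periodic_point T m x"
    using G(1) by blast
  then obtain m where m: "\<And>x. x \<in> G \<Longrightarrow> m x > 0 \<and> (T ^^ m x) x = x"
    unfolding periodic_point_def by (auto dest!: bchoice)
  \<comment> \<open>The product is a positive common multiple of the chosen periods.\<close>
  define N where "N = prod m G"
  have "N > 0"
    unfolding N_def using m by (simp add: prod_pos)
  have fixed: "(T ^^ N) x = x" if "x \<in> G" for x
    unfolding N_def
    by (rule funpow_fixed_mult[OF conjunct2[OF m[OF that]] dvd_prodI[where f = m, OF G(2) that]])
  obtain h where h: "bij_betw h {0..<card G} G"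
    using ex_bij_betw_nat_finite[OF G(2)] by blast
  have "{..<n} \<subseteq> {0..<card G}"
    using G(3) by auto
  then have inj_h: "inj_on h {..<n}"
    by (rule inj_on_subset[OF bij_betw_imp_inj_on[OF h]])
  have h_in: "h i \<in> G" if "i < n" for i
    using bij_betwE[OF h] G(3) that by simp
  have "inj_on (T ^^ k) (h ` {..<n})" for k
    by (rule inj_on_funpow_of_fixed[OF \<open>N > 0\<close>]) (auto simp: fixed h_in)
  from comp_inj_on[OF inj_h this] have "inj_on (\<lambda>i. (T ^^ k) (h i)) {..<n}" for k
    by (simp add: comp_def)
  from total_pairwise_dist_funpow_le[OF \<alpha>(1) contr this, of N]
  have "total_pairwise_dist n (\<lambda>i. (T ^^ N) (h i)) \<le> \<alpha> ^ N * total_pairwise_dist n h"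
    by simp
  moreover have "total_pairwise_dist n (\<lambda>i. (T ^^ N) (h i)) = total_pairwise_dist n h"
    by (rule total_pairwise_dist_cong) (simp add: fixed h_in)
  moreover have "\<alpha> ^ N < 1"
    using \<alpha> \<open>N > 0\<close> by (simp add: power_less_one_iff)
  moreover have "total_pairwise_dist n h > 0"
  proof -
    have "h 0 \<noteq> h 1"
      using inj_onD[OF inj_h, of 0 1] assms(1) by auto
    then have "0 < dist (h 0) (h 1)"
      by simp
    also have "\<dots> \<le> total_pairwise_dist n h"
      using assms(1) by (intro dist_le_total_pairwise_dist) auto
    finally show ?thesis .
  qed
  \<comment> \<open>With S the total distance of \<open>h\<close>, these facts give S \<le>
    \<alpha>^N S < S.\<close>
  ultimately show False
    by (smt (verit) mult_less_cancel_right2)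
qed

section \<open>Prime periods and cycles\<close>

lemma inj_on_orbit_least_power:
  "inj_on (\<lambda>i. (T ^^ i) x) {..<least_power T x}" if "(T ^^ m) x = x" "m > 0"
proof (rule linorder_inj_onI')
  let ?p = "least_power T x"
  fix i j
  assume ij: "i \<in> {..<?p}" "j \<in> {..<?p}" "i < j"
  show "(T ^^ i) x \<noteq> (T ^^ j) x"
  proof
    assume eq: "(T ^^ i) x = (T ^^ j) x"
    \<comment> \<open>Advancing both equal iterates by \<open>?p - j\<close> steps would return to
      \<open>x\<close> after fewer than \<open>?p\<close> steps.\<close>
    have "(T ^^ (?p - j + i)) x = (T ^^ (?p - j + j)) x"
      by (simp only: funpow_add comp_apply eq)
    also have "?p - j + j = ?p"
      using ij by simp
    also have "(T ^^ ?p) x = x"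
      by (rule least_powerI(1)[OF that])
    finally have "?p \<le> ?p - j + i"
      using ij by (intro least_power_le) auto
    with ij show False
      by simp
  qed
qed

text \<open>The whole orbit of \<open>x\<close> is periodic, and its first
  \<open>least_power T x\<close> members are distinct. Finiteness matters since \<open>card\<close>
  of an infinite set is 0.\<close>

lemma prime_period_le_card:
  assumes "finite {x. \<exists>m. periodic_point T m x}" "(T ^^ m) x = x" "m > 0"
  shows "least_power T x \<le> card {x. \<exists>m. periodic_point T m x}"
proof -
  have "periodic_point T m ((T ^^ i) x)" for i
  proof -
    have "(T ^^ m) ((T ^^ i) x) = (T ^^ i) ((T ^^ m) x)"
      by (simp only: funpow_add[THEN fun_cong, unfolded comp_apply, symmetric] add.commute)
    then show ?thesis
      using assms(2,3) by (simp add: periodic_point_def)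
  qed
  then have "(\<lambda>i. (T ^^ i) x) ` {..<least_power T x} \<subseteq> {x. \<exists>m. periodic_point T m x}"
    by blast
  from card_inj_on_le[OF inj_on_orbit_least_power[OF assms(2,3)] this assms(1)]
  show ?thesis
    by simp
qed

section \<open>Existence of a periodic point\<close>

lemma Cauchy_of_summable_dist:
  fixes u :: "nat \<Rightarrow> 'a::metric_space"
  assumes "summable c" "\<And>k. dist (u k) (u (Suc k)) \<le> c k"
  shows "Cauchy u"
proof (rule CauchyI')
  fix e :: real
  assume "e > 0"
  then obtain N where N: "\<And>m n. m \<ge> N \<Longrightarrow> norm (sum c {m..<n}) < e"
    using assms(1) unfolding summable_Cauchy by blast
  have le: "dist (u m) (u (m + k)) \<le> sum c {m..<m + k}" for m k
  proof (induction k)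
    case (Suc k)
    have "dist (u m) (u (m + Suc k)) \<le> dist (u m) (u (m + k)) + dist (u (m + k)) (u (Suc (m + k)))"
      using dist_triangle by simp
    also have "\<dots> \<le> sum c {m..<m + k} + c (m + k)"
      by (intro add_mono Suc.IH assms(2))
    finally show ?case
      by simp
  qed simp
  have "dist (u m) (u n) < e" if "m \<ge> N" "n > m" for m n
    using le[of m "n - m"] N[OF that(1), of n] that(2) by simp
  then show "\<exists>M. \<forall>m\<ge>M. \<forall>n>m. dist (u m) (u n) < e"
    by blast
qed

lemma fixed_point_of_inj_orbit:
  fixes T :: "'a::complete_space \<Rightarrow> 'a"
  assumes "n \<ge> 2" "contracting_total_pairwise_dist n T"
    and inj: "inj (\<lambda>k. (T ^^ k) a)"
  shows "\<exists>p. T p = p"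
proof -
  define u where "u k = (T ^^ k) a" for k
  have inj_u: "inj u"
    using inj by (simp add: u_def[abs_def])
  have T_u: "T (u k) = u (Suc k)" for k
    by (simp add: u_def)
  obtain \<alpha> where \<alpha>: "0 \<le> \<alpha>" "\<alpha> < 1"
    and contr: "\<And>x. inj_on x {..<n} \<Longrightarrow>
      total_pairwise_dist n (\<lambda>i. T (x i)) \<le> \<alpha> * total_pairwise_dist n x"
    using assms(2) unfolding contracting_total_pairwise_dist_def by blast
  have shift: "(T ^^ k) (u i) = u (k + i)" for k i
    by (simp add: u_def funpow_add)
  have "inj_on (\<lambda>i. (T ^^ k) (u i)) {..<n}" for k
    by (auto simp: shift inj_eq[OF inj_u] intro!: inj_onI)
  from total_pairwise_dist_funpow_le[OF \<alpha>(1) contr this]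
  have decay: "total_pairwise_dist n (\<lambda>i. u (k + i)) \<le> \<alpha> ^ k * total_pairwise_dist n u" for k
    by (simp add: shift)
  \<comment> \<open>The pair of indices 0 and 1 in the window starting at \<open>u k\<close> gives
    this distance.\<close>
  have "dist (u k) (u (Suc k)) \<le> \<alpha> ^ k * total_pairwise_dist n u" for k
    using dist_le_total_pairwise_dist[of 0 1 n "\<lambda>i. u (k + i)"] decay[of k] assms(1) by simp
  moreover have "summable (\<lambda>k. \<alpha> ^ k * total_pairwise_dist n u)"
    using \<alpha> by (intro summable_mult2 summable_geometric) simp
  ultimately have "Cauchy u"
    by (intro Cauchy_of_summable_dist)
  then obtain p where p: "u \<longlonglongrightarrow> p"
    using Cauchy_convergent convergent_def by blast
  \<comment> \<open>An injective orbit visits \<open>p\<close> at most once, so from some index on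
    \<open>p\<close> can be joined to a window without repetition.\<close>
  have "\<exists>K. \<forall>k\<ge>K. u k \<noteq> p"
  proof (cases "\<exists>k. u k = p")
    case True
    then obtain K where "p = u K"
      by blast
    then have "\<forall>k\<ge>Suc K. u k \<noteq> p"
      by (simp add: inj_eq[OF inj_u])
    then show ?thesis ..
  qed auto
  then obtain K where K: "\<And>k. k \<ge> K \<Longrightarrow> u k \<noteq> p"
    by blast
  \<comment> \<open>Placing \<open>p\<close> at index 0 and \<open>u k\<close> at index 1 makes the
    distance of their images a summand. As \<open>T\<close> is not assumed continuous, this replaces
    passing to the limit in \<open>T (u k)\<close>.\<close>
  define x where "x k i = (case i of 0 \<Rightarrow> p | Suc j \<Rightarrow> u (k + j))" for k i
  have "(\<lambda>k. x k i) \<longlonglongrightarrow> p" for i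
    by (cases i) (simp_all add: x_def LIMSEQ_ignore_initial_segment p)
  then have lim_x: "(\<lambda>k. total_pairwise_dist n (x k)) \<longlonglongrightarrow> 0"
    by (rule total_pairwise_dist_tendsto_0)
  have "dist (T p) (u (Suc k)) \<le> \<alpha> * total_pairwise_dist n (x k)" if "k \<ge> K" for k
  proof -
    have "inj_on (x k) {..<n}"
    proof (rule linorder_inj_onI')
      fix i j :: nat
      assume "i < j"
      then obtain j' where j: "j = Suc j'"
        by (cases j) auto
      have "p \<noteq> u (k + j')"
        using K[of "k + j'"] that by auto
      with \<open>i < j\<close> show "x k i \<noteq> x k j"
        by (cases i) (simp_all add: x_def j inj_eq[OF inj_u])
    qed
    from contr[OF this] show ?thesis
      using dist_le_total_pairwise_dist[of 0 1 n "\<lambda>i. T (x k i)"] assms(1)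
      by (simp add: x_def T_u)
  qed
  then have ev: "\<forall>\<^sub>F k in sequentially. dist (u (Suc k)) (T p) \<le> \<alpha> * total_pairwise_dist n (x k)"
    by (auto simp: eventually_sequentially dist_commute)
  have lim: "(\<lambda>k. \<alpha> * total_pairwise_dist n (x k)) \<longlonglongrightarrow> 0"
    using tendsto_mult_left[OF lim_x, of \<alpha>] by simp
  \<comment> \<open>The shifted orbit thus tends to \<open>T p\<close> as well as to
    \<open>p\<close>.\<close>
  have "(\<lambda>k. dist (u (Suc k)) (T p)) \<longlonglongrightarrow> 0"
    by (rule tendsto_sandwich[OF _ ev tendsto_const lim]) simp
  then have "(\<lambda>k. u (Suc k)) \<longlonglongrightarrow> T p"
    by (rule tendsto_dist_iff[THEN iffD2])
  then have "T p = p"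
    using LIMSEQ_Suc[OF p] by (rule LIMSEQ_unique)
  then show ?thesis ..
qed

lemma funpow_diff_fixed:
  assumes "i \<le> j" "(T ^^ i) a = (T ^^ j) a"
  shows "(T ^^ (j - i)) ((T ^^ i) a) = (T ^^ i) a"
proof -
  have "(T ^^ (j - i)) ((T ^^ i) a) = (T ^^ (j - i + i)) a"
    by (simp only: funpow_add comp_apply)
  also have "j - i + i = j"
    using assms(1) by simp
  finally show ?thesis
    by (simp only: assms(2))
qed

lemma ex_periodic_point:
  fixes T :: "'a::complete_space \<Rightarrow> 'a"
  assumes "n \<ge> 2" "contracting_total_pairwise_dist n T"
  shows "\<exists>m x. periodic_point T m x"
proof -
  fix a :: 'a
  show ?thesis
  proof (cases "inj (\<lambda>k. (T ^^ k) a)")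
    case True
    from fixed_point_of_inj_orbit[OF assms this] obtain p where "T p = p" ..
    then have "periodic_point T 1 p"
      by (simp add: periodic_point_def)
    then show ?thesis
      by blast
  next
    case False
    \<comment> \<open>The repeated value is periodic; the starting point \<open>a\<close> itself may
      lie outside the cycle.\<close>
    then obtain i j where ij: "i < j" "(T ^^ i) a = (T ^^ j) a"
      by (meson linorder_injI)
    have "periodic_point T (j - i) ((T ^^ i) a)"
      unfolding periodic_point_def
      using ij(1) funpow_diff_fixed[OF less_imp_le[OF ij(1)] ij(2)] by (intro conjI) simp_all
    then show ?thesis
      by blast
  qed
qed

theorem theorem2p2:
  fixes n :: nat and T :: "'a::complete_space \<Rightarrow> 'a"
  assumes "n \<ge> 2"
    and "infinite (UNIV :: 'a set) \<or> card (UNIV :: 'a set) \<ge> n"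
    and "contracting_total_pairwise_dist n T"
  shows "(\<exists>k\<in>{1..n - 1}. \<exists>x. has_prime_period T k x) \<and>
    finite {x. \<exists>m. periodic_point T m x} \<and>
    card {x. \<exists>m. periodic_point T m x} \<le> n - 1"
proof (intro conjI)
  note fin = finite_periodic_points[OF assms(1,3)]
  from fin show "finite {x. \<exists>m. periodic_point T m x}"
    and "card {x. \<exists>m. periodic_point T m x} \<le> n - 1"
    by blast+
  obtain m x where "periodic_point T m x"
    using ex_periodic_point[OF assms(1,3)] by blast
  then have x: "(T ^^ m) x = x" "m > 0"
    by (simp_all add: periodic_point_def)
  have "has_prime_period T (least_power T x) x"
    using least_powerI[OF x] by (simp add: has_prime_period_def periodic_point_def)
  \<comment> \<open>The upper bound goes through the number of periodic points, which is at most
    \<open>n - 1\<close>.\<close>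
  moreover have "least_power T x \<in> {1..n - 1}"
    using prime_period_le_card[OF _ x] fin least_powerI(2)[OF x] by fastforce
  ultimately show "\<exists>k\<in>{1..n - 1}. \<exists>x. has_prime_period T k x"
    by blast
qed

end
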